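(* Let $m \ge 2$ and $K = 2^{m-1}-m$. If $[i_1,\ldots,i_K]$ and $[i'_1,\ldots,i'_K]$ are stepping sequences for $m-1$, then $$[i_1+1,i_2+1,\ldots,i_K+1] \cup [1,2,\ldots,m-1] \cup [i'_1,i'_2,\ldots,i'_K]$$ and $$[i_1,i_2,\ldots,i_K] \cup [m-1,m-2,\ldots,1] \cup [i'_1+1,i'_2+1,\ldots,i'_K+1]$$ are stepping sequences for $m$.
   Context: For $n \ge 1$, start with the nested chain $S_0 \subset S_1 \subset \cdots \subset S_n$ where $S_i=\{1,\ldots,i\}$ (so $\#S_i=i$). A move with index $i$, $1\le i\le n-1$, replaces $S_i$ by $S_i^* = S_{i-1}\cup(S_{i+1}\setminus S_i)$ (this keeps the chain nested with $\#S_i=i$); the set produced by the move is the new value of $S_i$. A finite sequence $[i_1,\ldots,i_N]$ with entries in $\{1,\ldots,n-1\}$ is a stepping sequence for $n$ if, applying the moves $i_1,\ldots,i_N$ successively starting from this chain, the sets produced by the moves, together with the initial sets $S_0,\ldots,S_n$, contain every subset of $\{1,\ldots,n\}$ exactly once (so $N=2^n-n-1$). Here $\cup$ between sequences denotes concatenation. *)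

theory Defs
  imports Main
begin

text \<open>A chain is encoded as a function \<open>S :: nat \<Rightarrow> nat set\<close>; for stepping sequences for \<open>n\<close>
  only the values \<open>S 0, \<dots>, S n\<close> matter.\<close>

definition initial_chain :: "nat \<Rightarrow> nat set" where
  "initial_chain i = {1..i}"

text \<open>Moves are only used with \<open>i \<ge> 1\<close>, so \<open>i - 1\<close> is never truncated.\<close>

definition move :: "nat \<Rightarrow> (nat \<Rightarrow> nat set) \<Rightarrow> nat \<Rightarrow> nat set" where
  "move i S = S(i := S (i - 1) \<union> (S (i + 1) - S i))"

fun produced_sets :: "(nat \<Rightarrow> nat set) \<Rightarrow> nat list \<Rightarrow> nat set list" where
  "produced_sets S [] = []"
| "produced_sets S (i # xs) = move i S i # produced_sets (move i S) xs"

definition stepping_sequence :: "nat \<Rightarrow> nat list \<Rightarrow> bool" where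
  "stepping_sequence n xs \<longleftrightarrow>
     n \<ge> 1 \<and> set xs \<subseteq> {1..n - 1} \<and>
     (\<forall>A. A \<subseteq> {1..n} \<longrightarrow>
        count_list (map initial_chain [0..<n + 1] @ produced_sets initial_chain xs) A = 1)"

end

theory Submission
  imports Defs "HOL-Combinatorics.Transposition"
begin

text \<open>
  A move with index \<open>i\<close> swaps the elements entering a maximal chain at steps \<open>i\<close> and \<open>i + 1\<close>,
  so maximal chains stay maximal, and up to relabelling the ground set they all look like the
  initial one. Hence a stepping sequence for \<open>m - 1\<close>, run on any interval of a chain that is
  maximal between \<open>B\<close> and \<open>B \<union> V\<close> with \<open>card V = m - 1\<close>, visits each set between \<open>B\<close> and
  \<open>B \<union> V\<close> once.

  In the first sequence the shifted block visits the sets containing \<open>1\<close>; the sweep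
  \<open>1, \<dots>, m - 1\<close> then removes \<open>1\<close> from the chain, producing a maximal chain of \<open>{2..m}\<close>, and the last
  block visits the remaining subsets of \<open>{2..m}\<close>. In the second sequence the first block visits
  the sets without \<open>m\<close>, the sweep \<open>m - 1, \<dots>, 1\<close> inserts \<open>m\<close> everywhere, and the shifted block
  visits the sets containing \<open>m\<close>.
\<close>

section \<open>Runs of moves on maximal chains\<close>

lemma fold_move_other: "i \<notin> set xs \<Longrightarrow> fold move xs S i = S i"
  by (induction xs arbitrary: S) (auto simp: move_def)

lemma produced_sets_append:
  "produced_sets S (xs @ ys) = produced_sets S xs @ produced_sets (fold move xs S) ys"
  by (induction xs arbitrary: S) auto

text \<open>When no index repeats, a set written by a move is never overwritten, so it can be read
  off the final chain. The sweeps are of this kind.\<close>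

lemma produced_sets_distinct:
  "distinct xs \<Longrightarrow> produced_sets S xs = map (fold move xs S) xs"
  by (induction xs arbitrary: S) (auto simp: fold_move_other)

text \<open>\<open>f\<close> lists the elements in their order of entry into the chain. The move
  interchanges entries \<open>i\<close> and \<open>i + 1\<close>, so the witness is \<open>f\<close>
  composed with that transposition.\<close>

lemma move_image_chain:
  assumes "bij_betw f {1..n} V" "\<And>i. i \<le> n \<Longrightarrow> S i = f ` {1..i}" "1 \<le> i" "i < n"
  shows "\<exists>g. bij_betw g {1..n} V \<and> (\<forall>j\<le>n. move i S j = g ` {1..j})"
proof -
  let ?t = "transpose i (i + 1)"
  have "?t ` {1..n} = {1..n}"
    using assms(3,4) by (intro transpose_image_eq) auto
  then have "bij_betw ?t {1..n} {1..n}"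
    by (auto simp: bij_betw_def intro: inj_on_subset[OF inj_transpose])
  then have "bij_betw (f \<circ> ?t) {1..n} V"
    using assms(1) bij_betw_trans by blast
  moreover have "move i S j = (f \<circ> ?t) ` {1..j}" if "j \<le> n" for j
  proof (cases "j = i")
    case True
    have inj: "inj_on f {1..n}"
      using assms(1) by (simp add: bij_betw_def)
    have "f ` {1..i + 1} - f ` {1..i} = f ` ({1..i + 1} - {1..i})"
      using assms(4) by (intro inj_on_image_set_diff[OF inj, symmetric]) auto
    also have "{1..i + 1} - {1..i} = {i + 1}" by auto
    finally have "move i S i = f ` ({1..i - 1} \<union> {i + 1})"
      using assms by (simp add: move_def image_Un)
    moreover have "{1..i} = {1..i - 1} \<union> {i}" using assms(3) by auto
    then have "?t ` {1..i} = ?t ` {1..i - 1} \<union> {i + 1}"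
      by simp
    moreover have "?t ` {1..i - 1} = {1..i - 1}"
      using assms(3) by (intro transpose_image_eq) auto
    ultimately show ?thesis using True by (metis image_comp)
  next
    case False
    \<comment> \<open>For \<open>j\<close> other than \<open>i\<close>, the segment contains both or
      neither of the swapped points.\<close>
    then have "?t ` {1..j} = {1..j}"
      using assms(3) by (intro transpose_image_eq) auto
    then show ?thesis
      using False assms(2)[OF that] by (simp add: move_def flip: image_image)
  qed
  ultimately show ?thesis by blast
qed

lemma fold_move_image_chain:
  assumes "bij_betw f {1..n} V" "\<And>i. i \<le> n \<Longrightarrow> S i = f ` {1..i}" "set xs \<subseteq> {1..n - 1}"
  shows "\<exists>g. bij_betw g {1..n} V \<and> (\<forall>j\<le>n. fold move xs S j = g ` {1..j})"
  using assms
proof (induction xs arbitrary: f S)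
  case Nil
  then show ?case by auto
next
  case (Cons i xs)
  have "1 \<le> i" "i < n" using Cons.prems(3) by auto
  then obtain h where "bij_betw h {1..n} V" "\<forall>j\<le>n. move i S j = h ` {1..j}"
    using move_image_chain[OF Cons.prems(1,2)] by blast
  then show ?case using Cons.IH[of h "move i S"] Cons.prems(3) by auto
qed

lemma produced_sets_subset:
  assumes "\<And>i. i \<le> n \<Longrightarrow> S i \<subseteq> V" "set xs \<subseteq> {1..n - 1}"
  shows "set (produced_sets S xs) \<subseteq> Pow V"
  using assms
proof (induction xs arbitrary: S)
  case Nil
  then show ?case by simp
next
  case (Cons i xs)
  have "i - 1 \<le> n" "i + 1 \<le> n" using Cons.prems(2) by auto
  then have *: "S (i - 1) \<subseteq> V" "S (i + 1) \<subseteq> V"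
    using Cons.prems(1) by blast+
  then have "move i S j \<subseteq> V" if "j \<le> n" for j
    using Cons.prems(1)[OF that] by (auto simp: move_def)
  moreover have "move i S i \<subseteq> V" using * by (auto simp: move_def)
  ultimately show ?case using Cons.IH[of "move i S"] Cons.prems(2) by simp
qed

section \<open>Stepping sequences as enumerations of a power set\<close>

lemma distinct_iff_count_list: "distinct xs \<longleftrightarrow> (\<forall>x\<in>set xs. count_list xs x = 1)"
  by (induction xs) (auto simp: count_list_0_iff)

text \<open>The definition counts only subsets of \<open>{1..n}\<close>. Moves with indices in range
  never leave the ground set, so no other set is listed and the counts amount to distinctness
  together with the exact range.\<close>

lemma stepping_sequence_iff:
  "stepping_sequence n xs \<longleftrightarrow> n \<ge> 1 \<and> set xs \<subseteq> {1..n - 1} \<and>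
     distinct (map initial_chain [0..<n + 1] @ produced_sets initial_chain xs) \<and>
     set (map initial_chain [0..<n + 1] @ produced_sets initial_chain xs) = Pow {1..n}"
proof (cases "n \<ge> 1 \<and> set xs \<subseteq> {1..n - 1}")
  case True
  let ?L = "map initial_chain [0..<n + 1] @ produced_sets initial_chain xs"
  have "set (produced_sets initial_chain xs) \<subseteq> Pow {1..n}"
    using True by (intro produced_sets_subset) (auto simp: initial_chain_def)
  then have sub: "set ?L \<subseteq> Pow {1..n}"
    by (auto simp: initial_chain_def)
  have "(\<forall>A. A \<subseteq> {1..n} \<longrightarrow> count_list ?L A = 1) \<longleftrightarrow> distinct ?L \<and> set ?L = Pow {1..n}"
    (is "?l \<longleftrightarrow> ?r")
  proof
    assume l: ?l
    have "A \<in> set ?L" if "A \<subseteq> {1..n}" for A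
      using l that by (metis count_list_0_iff zero_neq_one)
    then have "set ?L = Pow {1..n}" using sub by blast
    moreover from this have "distinct ?L"
      using l by (simp only: distinct_iff_count_list) blast
    ultimately show ?r by blast
  next
    assume r: ?r
    then show ?l by (simp only: distinct_iff_count_list) blast
  qed
  then show ?thesis using True by (simp only: stepping_sequence_def)
qed (auto simp: stepping_sequence_def)

section \<open>Transport to intervals of the subset lattice\<close>

lemma fold_move_relabel:
  assumes "inj_on f {1..n}" "B \<inter> f ` {1..n} = {}" "set xs \<subseteq> {1..n - 1}"
    and "\<And>i. i \<le> n \<Longrightarrow> T i \<subseteq> {1..n}"
    and "\<And>i. i \<le> n \<Longrightarrow> S (i + k) = B \<union> f ` T i"
  shows "produced_sets S (map (\<lambda>i. i + k) xs) = map (\<lambda>A. B \<union> f ` A) (produced_sets T xs)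
    \<and> (\<forall>i\<le>n. fold move (map (\<lambda>i. i + k) xs) S (i + k) = B \<union> f ` fold move xs T i)"
  using assms(3-)
proof (induction xs arbitrary: S T)
  case Nil
  then show ?case by simp
next
  case (Cons i xs)
  have i: "1 \<le> i" "i \<le> n" "i - 1 \<le> n" "i + 1 \<le> n" using Cons.prems(1) by auto
  note sub = Cons.prems(2)[OF i(2)] Cons.prems(2)[OF i(3)] Cons.prems(2)[OF i(4)]
  \<comment> \<open>A move uses only union and difference: injectivity carries \<open>f\<close>
    through the difference, and disjointness makes the common part \<open>B\<close> cancel.\<close>
  have "f ` (T (i + 1) - T i) = f ` T (i + 1) - f ` T i"
    using sub by (intro inj_on_image_set_diff[OF assms(1)]) auto
  moreover have "(B \<union> f ` T (i + 1)) - (B \<union> f ` T i) = f ` T (i + 1) - f ` T i"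
    using assms(2) sub by blast
  \<comment> \<open>Since \<open>i\<close> is positive, the subtraction does not truncate before the
    shift by \<open>k\<close>.\<close>
  moreover have "i + k - 1 = i - 1 + k" "i + k + 1 = i + 1 + k" using i by auto
  ultimately have new: "move (i + k) S (i + k) = B \<union> f ` move i T i"
    unfolding move_def fun_upd_same
    by (simp only: Cons.prems(3)[OF i(2)] Cons.prems(3)[OF i(3)] Cons.prems(3)[OF i(4)] image_Un Un_assoc)
  have "move (i + k) S (j + k) = B \<union> f ` move i T j" if "j \<le> n" for j
    using new Cons.prems(3)[OF that] by (cases "j = i") (auto simp: move_def)
  moreover have "move i T j \<subseteq> {1..n}" if "j \<le> n" for j
    using sub Cons.prems(2)[OF that] unfolding move_def by (auto split: if_splits)
  ultimately show ?case
    using Cons.IH[of "move i T" "move (i + k) S"] Cons.prems(1) new by auto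
qed

text \<open>Here \<open>B\<close> sits at position \<open>k\<close> of the chain and the elements of
  \<open>V\<close> enter after it in the order \<open>f\<close>. The last conclusion says that the
  chain is still maximal in the interval after the run, so that a further block can start from
  it.\<close>

lemma stepping_sequence_relabel:
  assumes xs: "stepping_sequence n xs"
    and f: "bij_betw f {1..n} V" and disj: "B \<inter> V = {}"
    and S: "\<And>i. i \<le> n \<Longrightarrow> S (i + k) = B \<union> f ` {1..i}"
  shows "distinct (map S [k..<n + 1 + k] @ produced_sets S (map (\<lambda>i. i + k) xs))" (is "distinct ?L")
    and "set (map S [k..<n + 1 + k] @ produced_sets S (map (\<lambda>i. i + k) xs)) = {A. B \<subseteq> A \<and> A \<subseteq> B \<union> V}"
    and "\<exists>g. bij_betw g {1..n} V \<and>
           (\<forall>i\<le>n. fold move (map (\<lambda>i. i + k) xs) S (i + k) = B \<union> g ` {1..i})"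
proof -
  let ?\<phi> = "\<lambda>A. B \<union> f ` A"
  let ?I = "map initial_chain [0..<n + 1] @ produced_sets initial_chain xs"
  have inj: "inj_on f {1..n}" and im: "f ` {1..n} = V" using f by (auto simp: bij_betw_def)
  have rng: "set xs \<subseteq> {1..n - 1}" and I: "distinct ?I" "set ?I = Pow {1..n}"
    using xs by (simp_all only: stepping_sequence_iff)
  have rel: "produced_sets S (map (\<lambda>i. i + k) xs) = map ?\<phi> (produced_sets initial_chain xs)
    \<and> (\<forall>i\<le>n. fold move (map (\<lambda>i. i + k) xs) S (i + k) = B \<union> f ` fold move xs initial_chain i)"
    by (rule fold_move_relabel[OF inj _ rng]) (use im disj S in \<open>auto simp: initial_chain_def\<close>)
  have "[k..<n + 1 + k] = map (\<lambda>i. i + k) [0..<n + 1]"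
    by (simp only: map_add_upt add_0)
  then have "map S [k..<n + 1 + k] = map ?\<phi> (map initial_chain [0..<n + 1])"
    using S by (auto simp: initial_chain_def simp del: upt_Suc)
  then have L: "?L = map ?\<phi> ?I" using rel by simp
  have "inj_on ?\<phi> (Pow {1..n})"
  proof (rule inj_onI)
    fix A C assume A: "A \<in> Pow {1..n}" and C: "C \<in> Pow {1..n}" and eq: "?\<phi> A = ?\<phi> C"
    then have "f ` A = f ` C" using im disj by blast
    then show "A = C" using inj A C by (simp add: inj_on_image_eq_iff)
  qed
  then show "distinct ?L"
    unfolding L distinct_map using I by simp
  have "?\<phi> ` Pow {1..n} = (\<union>) B ` Pow V"
    by (simp add: image_image flip: image_Pow_surj[OF im])
  also have "\<dots> = {A. B \<subseteq> A \<and> A \<subseteq> B \<union> V}"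
    by (auto intro!: image_eqI[of _ _ "_ - B"])
  finally show "set ?L = {A. B \<subseteq> A \<and> A \<subseteq> B \<union> V}"
    unfolding L using I(2) by (simp only: set_map)
  \<comment> \<open>The run reorders \<open>{1..n}\<close> by \<open>g\<close>; relabelling by
    \<open>f\<close> afterwards gives the witness \<open>f \<circ> g\<close>.\<close>
  have "\<exists>g. bij_betw g {1..n} {1..n} \<and> (\<forall>j\<le>n. fold move xs initial_chain j = g ` {1..j})"
    by (rule fold_move_image_chain[OF bij_betw_id _ rng]) (simp add: initial_chain_def)
  then obtain g where g: "bij_betw g {1..n} {1..n}"
    "\<forall>j\<le>n. fold move xs initial_chain j = g ` {1..j}" by blast
  have "bij_betw (f \<circ> g) {1..n} V" using bij_betw_trans[OF g(1) f] .
  with rel g(2) show "\<exists>g. bij_betw g {1..n} V \<and>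
           (\<forall>i\<le>n. fold move (map (\<lambda>i. i + k) xs) S (i + k) = B \<union> g ` {1..i})"
    by (intro exI[of _ "f \<circ> g"]) (simp add: image_comp)
qed

section \<open>Monotone sweeps through a chain\<close>

lemma Pow_insert_eq: "Pow ({x} \<union> V) = Pow V \<union> {A. {x} \<subseteq> A \<and> A \<subseteq> {x} \<union> V}"
  by blast

text \<open>When the sweep reaches index \<open>i\<close>, position \<open>i - 1\<close> already
  holds \<open>S i - S 1\<close>; the move adds the increment \<open>S (i + 1) - S i\<close>. So
  \<open>S 1\<close> is removed while the sets slide down by one position.\<close>

lemma fold_move_upt:
  assumes "S 0 = {}" "\<And>i. 1 \<le> i \<Longrightarrow> i \<le> m \<Longrightarrow> S 1 \<subseteq> S i"
    and "\<And>i. i < m \<Longrightarrow> S i \<subseteq> S (i + 1)" "1 \<le> m"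
  shows "fold move [1..<m] S = (\<lambda>i. if 1 \<le> i \<and> i < m then S (i + 1) - S 1 else S i)"
  using assms(4,2,3)
proof (induction m rule: dec_induct)
  case base
  then show ?case by (auto simp: fun_eq_iff)
next
  case (step m)
  define T where "T = fold move [1..<m] S"
  have T: "T i = (if 1 \<le> i \<and> i < m then S (i + 1) - S 1 else S i)" for i
    unfolding T_def using step by simp
  have "S 1 \<subseteq> S m" "S m \<subseteq> S (m + 1)" using step by auto
  \<comment> \<open>For \<open>m = 1\<close> the lower neighbour is the untouched
    \<open>S 0 = {}\<close>, which equals \<open>S 1 - S 1\<close>.\<close>
  then have new: "T (m - 1) \<union> (T (m + 1) - T m) = S (m + 1) - S 1"
    unfolding T using assms(1) step.hyps by (cases "m = 1") auto
  have "fold move [1..<Suc m] S = move m T"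
    using step.hyps by (simp add: T_def)
  also have "\<dots> = (\<lambda>i. if 1 \<le> i \<and> i < Suc m then S (i + 1) - S 1 else S i)"
    unfolding move_def new using step.hyps by (intro ext) (simp add: T less_Suc_eq)
  finally show ?case .
qed

text \<open>Dual to the upward sweep: the set above position \<open>i\<close> has already become
  \<open>S i\<close> plus the top increment \<open>S m - S (m - 1)\<close>, so subtracting
  \<open>S i\<close> leaves just that increment. The induction lowers the end \<open>j\<close> of
  the sweep.\<close>

lemma fold_move_rev_upt:
  assumes "\<And>i. i < m \<Longrightarrow> S i \<subseteq> S (m - 1)" "j \<le> m" "1 \<le> j"
  shows "fold move (rev [j..<m]) S
    = (\<lambda>i. if j \<le> i \<and> i < m then S (i - 1) \<union> (S m - S (m - 1)) else S i)"
  using assms(2,3)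
proof (induction j rule: inc_induct)
  case base
  then show ?case by (auto simp: fun_eq_iff)
next
  case (step j)
  define T where "T = fold move (rev [Suc j..<m]) S"
  have T: "T i = (if Suc j \<le> i \<and> i < m then S (i - 1) \<union> (S m - S (m - 1)) else S i)" for i
    unfolding T_def using step by simp
  have "S j \<subseteq> S (m - 1)" using step assms(1) by simp
  then have new: "T (j - 1) \<union> (T (j + 1) - T j) = S (j - 1) \<union> (S m - S (m - 1))"
    unfolding T using step.hyps by (cases "Suc j = m") auto
  have "fold move (rev [j..<m]) S = move j T"
    using step.hyps by (simp add: T_def upt_conv_Cons)
  also have "\<dots> = (\<lambda>i. if j \<le> i \<and> i < m then S (i - 1) \<union> (S m - S (m - 1)) else S i)"
    unfolding move_def new using step.hyps by (intro ext) (simp add: T Suc_le_eq)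
  finally show ?case .
qed

section \<open>The two block constructions\<close>

lemma stepping_sequence_up:
  assumes xs: "stepping_sequence n xs" and ys: "stepping_sequence n ys"
  shows "stepping_sequence (n + 1) (map (\<lambda>i. i + 1) xs @ [1..<n + 1] @ ys)"
proof -
  let ?V = "{2..n + 1}"
  let ?S1 = "fold move (map (\<lambda>i. i + 1) xs) initial_chain"
  let ?S2 = "fold move [1..<n + 1] ?S1"
  have n: "n \<ge> 1" and rng: "set xs \<subseteq> {1..n - 1}" "set ys \<subseteq> {1..n - 1}"
    using xs ys by (simp_all only: stepping_sequence_def)
  have Suc: "bij_betw Suc {1..n} ?V"
    by (simp add: bij_betw_def numeral_2_eq_2)
  have init: "initial_chain (i + 1) = {1} \<union> Suc ` {1..i}" for i
    by (auto simp: initial_chain_def image_Suc_atLeastAtMost)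
  have disj: "{1} \<inter> ?V = {}" by auto
  note X = stepping_sequence_relabel[OF xs Suc disj init]
  obtain g where g: "bij_betw g {1..n} ?V"
    and S1: "\<And>i. i \<le> n \<Longrightarrow> ?S1 (i + 1) = {1} \<union> g ` {1..i}"
    using X(3) by blast
  have S1_0: "?S1 0 = {}" by (subst fold_move_other) (auto simp: initial_chain_def)
  have S1': "?S1 i = {1} \<union> g ` {1..i - 1}" if "1 \<le> i" "i \<le> n + 1" for i
    using S1[of "i - 1"] that by simp
  have "?S2 = (\<lambda>i. if 1 \<le> i \<and> i < n + 1 then ?S1 (i + 1) - ?S1 1 else ?S1 i)"
  proof (rule fold_move_upt)
    show "?S1 1 \<subseteq> ?S1 i" if "1 \<le> i" "i \<le> n + 1" for i
      using S1'[of 1] S1'[OF that] by auto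
    show "?S1 i \<subseteq> ?S1 (i + 1)" if "i < n + 1" for i
      using S1_0 S1'[of i] S1[of i] that by (cases "i = 0") auto
  qed (use S1_0 in auto)
  moreover have "{1} \<union> g ` {1..i} - {1} = g ` {1..i}" if "i \<le> n" for i
    using g that disj unfolding bij_betw_def by fastforce
  \<comment> \<open>Written with \<open>+ 0\<close> and \<open>{} \<union>\<close> to match the
    relabelling result for \<open>k = 0\<close> and \<open>B = {}\<close>.\<close>
  ultimately have S2: "?S2 (i + 0) = {} \<union> g ` {1..i}" if "i \<le> n" for i
    using S1[of i] S1'[of 1] S1_0 that by (cases "i = 0") auto
  note Y = stepping_sequence_relabel[OF ys g Int_empty_left S2]
  \<comment> \<open>The listed sets without \<open>1\<close>: the initial empty set, the sweep and
    the last block. The empty set and the sweep together are positions \<open>0\<close> to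
    \<open>n\<close> of the swept chain, as the relabelling result requires.\<close>
  let ?Q = "{} # produced_sets ?S1 [1..<n + 1] @ produced_sets ?S2 ys"
  have S2_list: "map ?S2 [0..<n + 1 + 0] = {} # map ?S2 [1..<n + 1]"
    using S2[of 0] by (simp add: upt_conv_Cons del: upt_Suc)
  have P: "produced_sets ?S1 [1..<n + 1] = map ?S2 [1..<n + 1]"
    by (rule produced_sets_distinct) simp
  have Q: "?Q = map ?S2 [0..<n + 1 + 0] @ produced_sets ?S2 (map (\<lambda>i. i + 0) ys)"
    unfolding S2_list P by simp
  have "{A. {} \<subseteq> A \<and> A \<subseteq> {} \<union> ?V} = Pow ?V" by auto
  then have Y': "distinct ?Q" "set ?Q = Pow ?V"
    unfolding Q using Y(1,2) by (simp_all only:)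
  have init_list: "map initial_chain [0..<n + 1 + 1] = {} # map initial_chain [1..<n + 1 + 1]"
    by (simp add: upt_conv_Cons initial_chain_def del: upt_Suc)
  have L: "set (map initial_chain [0..<n + 1 + 1] @
      produced_sets initial_chain (map (\<lambda>i. i + 1) xs @ [1..<n + 1] @ ys))
      = {A. {1} \<subseteq> A \<and> A \<subseteq> {1} \<union> ?V} \<union> Pow ?V"
    unfolding init_list produced_sets_append X(2)[symmetric] Y'(2)[symmetric]
    by (simp add: Un_ac del: upt_Suc)
  \<comment> \<open>Membership of \<open>1\<close> separates the two families, so the halves of the
    list cannot overlap.\<close>
  have "{A. {1} \<subseteq> A \<and> A \<subseteq> {1} \<union> ?V} \<inter> Pow ?V = {}" by auto
  then have "distinct ((map initial_chain [1..<n + 1 + 1] @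
      produced_sets initial_chain (map (\<lambda>i. i + 1) xs)) @ ?Q)"
    unfolding distinct_append[of _ ?Q] X(2) Y'(2) using X(1) Y'(1) by blast
  then have "distinct (map initial_chain [0..<n + 1 + 1] @
      produced_sets initial_chain (map (\<lambda>i. i + 1) xs @ [1..<n + 1] @ ys))"
    unfolding init_list produced_sets_append by (auto simp del: upt_Suc)
  moreover have "{1..n + 1} = {1} \<union> ?V" by auto
  then have "{A. {1} \<subseteq> A \<and> A \<subseteq> {1} \<union> ?V} \<union> Pow ?V = Pow {1..n + 1}"
    by (simp only: Pow_insert_eq Un_commute)
  moreover have "set (map (\<lambda>i. i + 1) xs @ [1..<n + 1] @ ys) \<subseteq> {1..n + 1 - 1}"
    using rng n by fastforce
  ultimately show ?thesis using L by (simp only: stepping_sequence_iff) simp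
qed

lemma stepping_sequence_down:
  assumes xs: "stepping_sequence n xs" and ys: "stepping_sequence n ys"
  shows "stepping_sequence (n + 1) (xs @ rev [1..<n + 1] @ map (\<lambda>i. i + 1) ys)"
proof -
  let ?V = "{1..n}"
  let ?S1 = "fold move xs initial_chain"
  let ?S2 = "fold move (rev [1..<n + 1]) ?S1"
  have n: "n \<ge> 1" and rng: "set xs \<subseteq> {1..n - 1}" "set ys \<subseteq> {1..n - 1}"
    using xs ys by (simp_all only: stepping_sequence_def)
  \<comment> \<open>The first block runs unshifted on the initial chain, so no relabelling is
    involved.\<close>
  have X: "distinct (map initial_chain [0..<n + 1] @ produced_sets initial_chain xs)"
    "set (map initial_chain [0..<n + 1] @ produced_sets initial_chain xs) = Pow ?V"
    using xs by (simp_all only: stepping_sequence_iff)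
  have "\<exists>g. bij_betw g {1..n} ?V \<and> (\<forall>i\<le>n. ?S1 i = g ` {1..i})"
    by (rule fold_move_image_chain[OF bij_betw_id _ rng(1)]) (simp add: initial_chain_def)
  then obtain g where g: "bij_betw g {1..n} ?V" and S1: "\<And>i. i \<le> n \<Longrightarrow> ?S1 i = g ` {1..i}"
    by blast
  have S1_top: "?S1 (n + 1) = {1..n + 1}"
    using rng by (subst fold_move_other) (auto simp: initial_chain_def)
  have S1_n: "?S1 n = {1..n}" using g S1[of n] by (simp add: bij_betw_def)
  have "?S2 = (\<lambda>i. if 1 \<le> i \<and> i < n + 1
      then ?S1 (i - 1) \<union> (?S1 (n + 1) - ?S1 (n + 1 - 1)) else ?S1 i)"
    by (rule fold_move_rev_upt) (use S1 in auto)
  moreover have "{1..n + 1} - {1..n} = {n + 1}" by auto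
  ultimately have S2: "?S2 (i + 1) = {n + 1} \<union> g ` {1..i}" if "i \<le> n" for i
    using S1_top S1_n S1[of i] that by (cases "i = n") auto
  have disj: "{n + 1} \<inter> ?V = {}" by auto
  note Y = stepping_sequence_relabel[OF ys g disj S2]
  have top: "?S2 (n + 1) = {1..n + 1}"
    using S1_top by (subst fold_move_other) auto
  have S2_list: "map ?S2 [1..<n + 1 + 1] = map ?S2 [1..<n + 1] @ [{1..n + 1}]"
    using top by simp
  \<comment> \<open>The listed sets containing \<open>n + 1\<close>. The full set comes from the
    initial chain: its position \<open>n + 1\<close> is never moved before the last block.\<close>
  let ?P = "{1..n + 1} # produced_sets ?S1 (rev [1..<n + 1]) @ produced_sets ?S2 (map (\<lambda>i. i + 1) ys)"
  have P: "produced_sets ?S1 (rev [1..<n + 1]) = rev (map ?S2 [1..<n + 1])"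
    by (simp add: produced_sets_distinct rev_map del: upt_Suc)
  \<comment> \<open>The downward sweep lists the chain in reverse, so \<open>?P\<close> agrees with
    the relabelled list only up to order; distinctness and range are transferred separately.\<close>
  have "distinct ?P"
    using Y(1) unfolding S2_list P by auto
  moreover have "set ?P = {A. {n + 1} \<subseteq> A \<and> A \<subseteq> {n + 1} \<union> ?V}"
    using Y(2) unfolding S2_list P by auto
  ultimately have Y': "distinct ?P" "set ?P = {A. {n + 1} \<subseteq> A \<and> A \<subseteq> {n + 1} \<union> ?V}"
    by blast+
  have init_list: "map initial_chain [0..<n + 1 + 1] = map initial_chain [0..<n + 1] @ [{1..n + 1}]"
    by (simp add: initial_chain_def)
  have L: "set (map initial_chain [0..<n + 1 + 1] @
      produced_sets initial_chain (xs @ rev [1..<n + 1] @ map (\<lambda>i. i + 1) ys))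
      = Pow ?V \<union> {A. {n + 1} \<subseteq> A \<and> A \<subseteq> {n + 1} \<union> ?V}"
    unfolding init_list produced_sets_append X(2)[symmetric] Y'(2)[symmetric]
    by (simp add: Un_ac del: upt_Suc)
  have "Pow ?V \<inter> {A. {n + 1} \<subseteq> A \<and> A \<subseteq> {n + 1} \<union> ?V} = {}" by auto
  then have "distinct ((map initial_chain [0..<n + 1] @ produced_sets initial_chain xs) @ ?P)"
    unfolding distinct_append[of _ ?P] X(2) Y'(2) using X(1) Y'(1) by blast
  then have "distinct (map initial_chain [0..<n + 1 + 1] @
      produced_sets initial_chain (xs @ rev [1..<n + 1] @ map (\<lambda>i. i + 1) ys))"
    unfolding init_list produced_sets_append by (auto simp del: upt_Suc)
  moreover have "{1..n + 1} = {n + 1} \<union> ?V" by auto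
  then have "Pow ?V \<union> {A. {n + 1} \<subseteq> A \<and> A \<subseteq> {n + 1} \<union> ?V} = Pow {1..n + 1}"
    by (simp only: Pow_insert_eq)
  moreover have "set (xs @ rev [1..<n + 1] @ map (\<lambda>i. i + 1) ys) \<subseteq> {1..n + 1 - 1}"
    using rng n by fastforce
  ultimately show ?thesis using L by (simp only: stepping_sequence_iff) simp
qed

theorem theorem2p1:
  fixes m K :: nat and xs ys :: "nat list"
  assumes "m \<ge> 2"
    and "K = 2 ^ (m - 1) - m"
    and "length xs = K" and "length ys = K"
    and "stepping_sequence (m - 1) xs"
    and "stepping_sequence (m - 1) ys"
  shows "stepping_sequence m (map (\<lambda>i. i + 1) xs @ [1..<m] @ ys)
       \<and> stepping_sequence m (xs @ rev [1..<m] @ map (\<lambda>i. i + 1) ys)"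
proof -
  have "m - 1 + 1 = m" using assms(1) by simp
  then show ?thesis
    using stepping_sequence_up[OF assms(5,6)] stepping_sequence_down[OF assms(5,6)] by metis
qed

end
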